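(* Let $I=(0,1)$, $\nu>0$, $\gamma>1$, and let $\rho_0\in C(\bar I)$ with $\rho_0>0$ in $I$, $\rho_0=0$ on $\partial I$, and $u_0$ continuous on $\bar I$. Suppose $(\rho_0,u_0)$ satisfy one of the two conditions: there exist positive $\lambda_1,\lambda_2,\lambda_3,\lambda_4$ with $0<\lambda_3,\lambda_4<1$ such that either ($\frac{(\rho_0)_x}{\rho_0}\ge\lambda_1$ in $(0,\lambda_3)$, $u_0(\lambda_3)<0$, $u_0\le0$ in $(0,\lambda_3)$) or ($\frac{(\rho_0)_x}{\rho_0}\le-\lambda_2$ in $(\lambda_4,1)$, $u_0(\lambda_4)>0$, $u_0\ge0$ in $(\lambda_4,1)$). Then for every $T>0$ the initial-boundary value problem $$\rho_t+(\rho u)_x=0,\quad (\rho u)_t+(\rho u^2+\rho^\gamma)_x=\nu u_{xx}\ \text{ in } I\times(0,T],$$ $$(\rho,u)=(\rho_0,u_0)\text{ on } I\times\{t=0\},\qquad \rho=u=u_x=0\text{ on }\partial I\times(0,T],$$ has no solution $(\rho,u)$ in $C^{2,1}(\bar I\times[0,T])$.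
   Context: $C^{2,1}(\bar I\times[0,T])$ denotes functions that are $C^2$ in $x$ and $C^1$ in $t$ on $\bar I\times[0,T]$. *)

theory Defs
  imports "HOL-Analysis.Analysis"
begin

definition C21 :: "real \<Rightarrow> (real \<Rightarrow> real \<Rightarrow> real) \<Rightarrow> bool" where
  "C21 T f \<longleftrightarrow>
    (\<exists>fx fxx ft.
      continuous_on ({0..1} \<times> {0..T}) (\<lambda>(x,t). f x t) \<and>
      continuous_on ({0..1} \<times> {0..T}) (\<lambda>(x,t). fx x t) \<and>
      continuous_on ({0..1} \<times> {0..T}) (\<lambda>(x,t). fxx x t) \<and>
      continuous_on ({0..1} \<times> {0..T}) (\<lambda>(x,t). ft x t) \<and>
      (\<forall>x\<in>{0..1}. \<forall>t\<in>{0..T}.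
         ((\<lambda>y. f y t) has_real_derivative fx x t) (at x within {0..1}) \<and>
         ((\<lambda>y. fx y t) has_real_derivative fxx x t) (at x within {0..1}) \<and>
         ((\<lambda>s. f x s) has_real_derivative ft x t) (at t within {0..T})))"

definition is_classical_solution ::
  "real \<Rightarrow> real \<Rightarrow> real \<Rightarrow> (real \<Rightarrow> real) \<Rightarrow> (real \<Rightarrow> real)
   \<Rightarrow> (real \<Rightarrow> real \<Rightarrow> real) \<Rightarrow> (real \<Rightarrow> real \<Rightarrow> real) \<Rightarrow> bool" where
  "is_classical_solution \<nu> \<gamma> T \<rho>0 u0 \<rho> u \<longleftrightarrow>
    C21 T \<rho> \<and> C21 T u \<and>
    \<comment> \<open>mass equation  rho_t + (rho u)_x = 0  in I x (0,T]\<close>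
    (\<forall>x\<in>{0<..<1}. \<forall>t\<in>{0<..T}. \<exists>a b.
        ((\<lambda>s. \<rho> x s) has_real_derivative a) (at t within {0..T}) \<and>
        ((\<lambda>y. \<rho> y t * u y t) has_real_derivative b) (at x) \<and>
        a + b = 0) \<and>
    \<comment> \<open>momentum equation (rho u)_t + (rho u^2 + rho^gamma)_x = nu u_xx  in I x (0,T]\<close>
    (\<forall>x\<in>{0<..<1}. \<forall>t\<in>{0<..T}. \<exists>a b c.
        ((\<lambda>s. \<rho> x s * u x s) has_real_derivative a) (at t within {0..T}) \<and>
        ((\<lambda>y. \<rho> y t * (u y t)\<^sup>2 + \<rho> y t powr \<gamma>) has_real_derivative b) (at x) \<and>
        ((\<lambda>y. deriv (\<lambda>z. u z t) y) has_real_derivative c) (at x) \<and>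
        a + b = \<nu> * c) \<and>
    \<comment> \<open>initial data on I x {t = 0}\<close>
    (\<forall>x\<in>{0<..<1}. \<rho> x 0 = \<rho>0 x \<and> u x 0 = u0 x) \<and>
    \<comment> \<open>boundary conditions rho = u = u_x = 0 on boundary of I x (0,T]\<close>
    (\<forall>t\<in>{0<..T}. \<forall>x\<in>{0, 1}.
        \<rho> x t = 0 \<and> u x t = 0 \<and>
        ((\<lambda>y. u y t) has_real_derivative 0) (at x within {0..1}))"

end

(* Near the left end point (the right one follows from the reflection x -> 1 - x, u -> -u) the
   density satisfies a transport equation, so rho >= 0 and rho_x >= 0 persist for a short time in a
   region into which no characteristic enters from outside. There the pressure is nondecreasing in x,
   and the velocity is a subsolution:  rho (u_t + u u_x) <= nu u_xx.
   Comparing u with  -eps (exp (k (x - a + c t)) - 1),  a wave that starts at a point a where u < 0 and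
   is fast enough to hit x = 0 within this short time, gives u_x < 0 at x = 0 at that time, in
   contradiction to the boundary condition u_x = 0. The density multiplies the time derivative and is
   merely bounded above, hence its vanishing at the boundary does no harm to the barrier. *)

theory Submission
  imports Defs
begin

section \<open>First- and second-order conditions at maxima\<close>

text \<open>A negative derivative would make \<open>g\<close> strictly larger just to the left of
  \<open>t\<close>. The comparison is one-sided and the derivative is taken within \<open>S\<close>,
  so the test also works at a final time or at an endpoint of an interval.\<close>

lemma has_real_derivative_nonneg_if_max_left:
  fixes g :: "real \<Rightarrow> real"
  assumes der: "(g has_real_derivative D) (at t within S)"
    and "a < t" "{a..t} \<subseteq> S"
    and max: "\<And>s. s \<in> {a..t} \<Longrightarrow> g s \<le> g t"
  shows "0 \<le> D"
proof (rule ccontr)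
  assume "\<not> 0 \<le> D"
  then obtain d where "d > 0" and d: "\<And>h. h > 0 \<Longrightarrow> t - h \<in> S \<Longrightarrow> h < d \<Longrightarrow> g t < g (t - h)"
    using has_real_derivative_neg_dec_left[OF der] by auto
  define h where "h = min (d / 2) (t - a)"
  have "h > 0" "h < d" "t - h \<in> {a..t}"
    using \<open>d > 0\<close> \<open>a < t\<close> by (auto simp: h_def min_def)
  moreover from this have "t - h \<in> S" using \<open>{a..t} \<subseteq> S\<close> by blast
  ultimately show False using d[of h] max[of "t - h"] by auto
qed

lemma has_real_derivative_nonpos_if_max_right:
  fixes g :: "real \<Rightarrow> real"
  assumes der: "(g has_real_derivative D) (at t within S)"
    and "t < b" "{t..b} \<subseteq> S"
    and max: "\<And>s. s \<in> {t..b} \<Longrightarrow> g s \<le> g t"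
  shows "D \<le> 0"
proof (rule ccontr)
  assume "\<not> D \<le> 0"
  then obtain d where "d > 0" and d: "\<And>h. h > 0 \<Longrightarrow> t + h \<in> S \<Longrightarrow> h < d \<Longrightarrow> g t < g (t + h)"
    using has_real_derivative_pos_inc_right[OF der] by auto
  define h where "h = min (d / 2) (b - t)"
  have "h > 0" "h < d" "t + h \<in> {t..b}"
    using \<open>d > 0\<close> \<open>t < b\<close> by (auto simp: h_def min_def)
  moreover from this have "t + h \<in> S" using \<open>{t..b} \<subseteq> S\<close> by blast
  ultimately show False using d[of h] max[of "t + h"] by auto
qed

text \<open>If \<open>D\<close> were positive, \<open>g'\<close> would be positive just to the right
  of its zero \<open>x\<close>, and the mean value theorem would produce a larger value of
  \<open>g\<close> there.\<close>

lemma second_derivative_nonpos_at_max: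
  fixes g g' :: "real \<Rightarrow> real"
  assumes der: "\<And>y. y \<in> {a<..<b} \<Longrightarrow> (g has_real_derivative g' y) (at y)"
    and der2: "(g' has_real_derivative D) (at x)"
    and x: "x \<in> {a<..<b}"
    and max: "\<And>y. y \<in> {a<..<b} \<Longrightarrow> g y \<le> g x"
  shows "g' x = 0" "D \<le> 0"
proof -
  show zero: "g' x = 0"
  proof (rule DERIV_local_max[OF der[OF x], of "min (x - a) (b - x)"])
    show "0 < min (x - a) (b - x)" using x by auto
    show "\<forall>y. \<bar>x - y\<bar> < min (x - a) (b - x) \<longrightarrow> g y \<le> g x"
      by (auto intro!: max)
  qed
  show "D \<le> 0"
  proof (rule ccontr)
    assume "\<not> D \<le> 0"
    then obtain d where "d > 0" and d: "\<And>h. h > 0 \<Longrightarrow> h < d \<Longrightarrow> g' x < g' (x + h)"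
      using has_real_derivative_pos_inc_right[OF der2] by auto
    define h where "h = min (d / 2) ((b - x) / 2)"
    have h: "h > 0" "h < d" "x + h < b"
      using \<open>d > 0\<close> x by (auto simp: h_def min_def field_simps)
    have "\<exists>z. x < z \<and> z < x + h \<and> g (x + h) - g x = (x + h - x) * g' z"
      using h x by (intro MVT2) (auto intro!: der)
    then obtain z where z: "x < z" "z < x + h" "g (x + h) - g x = h * g' z" by auto
    have "g' z > 0" using d[of "z - x"] z h zero by auto
    then have "g (x + h) > g x" using z h by (smt (verit) mult_pos_pos)
    then show False using max[of "x + h"] h x by auto
  qed
qed

section \<open>Minimum principle for a linear transport inequality\<close>

text \<open>The weight \<open>exp (- (K + 1) * t - N * (x - r + M * t))\<close> makes the values on the inflow side
  \<open>x = r\<close> irrelevant as \<open>N\<close> tends to infinity, because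
  \<open>x - r + M * t\<close> is nondecreasing along the flow.\<close>

lemma transport_nonneg:
  fixes f ft fx u d :: "real \<Rightarrow> real \<Rightarrow> real"
  assumes cont: "continuous_on ({0..r} \<times> {0..\<tau>}) (\<lambda>(x, t). f x t)"
    and der_t: "\<And>x t. x \<in> {0..<r} \<Longrightarrow> t \<in> {0<..\<tau>} \<Longrightarrow>
      ((\<lambda>s. f x s) has_real_derivative ft x t) (at t within {0..\<tau>})"
    and der_x: "\<And>x t. x \<in> {0..<r} \<Longrightarrow> t \<in> {0<..\<tau>} \<Longrightarrow>
      ((\<lambda>y. f y t) has_real_derivative fx x t) (at x within {0..r})"
    and u_bound: "\<And>x t. x \<in> {0..<r} \<Longrightarrow> t \<in> {0<..\<tau>} \<Longrightarrow> \<bar>u x t\<bar> \<le> M"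
    and d_bound: "\<And>x t. x \<in> {0..<r} \<Longrightarrow> t \<in> {0<..\<tau>} \<Longrightarrow> \<bar>d x t\<bar> \<le> K"
    and u_zero: "\<And>t. t \<in> {0<..\<tau>} \<Longrightarrow> u 0 t = 0"
    and ineq: "\<And>x t. x \<in> {0..<r} \<Longrightarrow> t \<in> {0<..\<tau>} \<Longrightarrow>
      0 \<le> ft x t + u x t * fx x t + d x t * f x t"
    and init: "\<And>x. x \<in> {0..r} \<Longrightarrow> 0 \<le> f x 0"
    and pt: "0 \<le> x0" "x0 + M * t0 < r" "0 \<le> t0" "t0 \<le> \<tau>" "0 \<le> M"
  shows "0 \<le> f x0 t0"
proof (rule ccontr)
  assume neg: "\<not> 0 \<le> f x0 t0"
  have x0r: "x0 \<in> {0..r}" using pt by (smt (verit) atLeastAtMost_iff mult_nonneg_nonneg)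
  have "compact ({0..r} \<times> {0..\<tau>})" by (intro compact_Times compact_Icc)
  from compact_continuous_image[OF cont this]
  have "bounded ((\<lambda>(x, t). f x t) ` ({0..r} \<times> {0..\<tau>}))" by (rule compact_imp_bounded)
  then obtain A where A: "\<And>x t. x \<in> {0..r} \<Longrightarrow> t \<in> {0..\<tau>} \<Longrightarrow> \<bar>f x t\<bar> \<le> A"
    unfolding bounded_iff by force
  define e where "e = r - x0 - M * t0"
  have "e > 0" using pt by (simp add: e_def)
  define c where "c = - f x0 t0 * exp (- (K + 1) * t0)"
  have "c > 0" using neg by (simp add: c_def mult_neg_pos)
  \<comment> \<open>\<open>A'\<close> bounds the weighted function on the side \<open>x = r\<close>
    uniformly in \<open>N \<ge> 0\<close>. The weighted value at \<open>(x0, t0)\<close> is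
    \<open>- c * exp (N * e)\<close>, where \<open>e > 0\<close> is the margin by which this point
    stays clear of the inflow, so a large \<open>N\<close> pushes it below
    \<open>- A'\<close>.\<close>
  define A' where "A' = A * exp (\<bar>K + 1\<bar> * \<tau>)"
  obtain N :: real where "N \<ge> 0" and N: "A' < c * exp (N * e)"
  proof -
    define N where "N = \<bar>A'\<bar> / (c * e)"
    have "\<bar>A'\<bar> = c * (N * e)" using \<open>c > 0\<close> \<open>e > 0\<close> by (simp add: N_def)
    also have "\<dots> < c * exp (N * e)"
      using exp_ge_add_one_self[of "N * e"] \<open>c > 0\<close> by (intro mult_strict_left_mono) linarith+
    finally have "A' < c * exp (N * e)" by linarith
    moreover have "N \<ge> 0" using \<open>c > 0\<close> \<open>e > 0\<close> by (simp add: N_def)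
    ultimately show ?thesis using that by blast
  qed
  define w where "w x t = exp (- (K + 1) * t - N * (x - r + M * t))" for x t
  define Y where "Y x t = f x t * w x t" for x t
  have "continuous_on ({0..r} \<times> {0..\<tau>}) (\<lambda>p. Y (fst p) (snd p))"
    unfolding Y_def w_def using cont by (auto intro!: continuous_intros simp: split_beta)
  from continuous_attains_inf[OF _ _ this] x0r pt
  obtain p where p: "p \<in> {0..r} \<times> {0..\<tau>}"
      "\<forall>q \<in> {0..r} \<times> {0..\<tau>}. Y (fst p) (snd p) \<le> Y (fst q) (snd q)"
    by (force intro: compact_Times compact_Icc)
  define x t where "x = fst p" and "t = snd p"
  have xt: "x \<in> {0..r}" "t \<in> {0..\<tau>}" using p by (auto simp: x_def t_def mem_Times_iff)
  have min: "Y x t \<le> Y y s" if "y \<in> {0..r}" "s \<in> {0..\<tau>}" for y s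
    using p(2)[rule_format, of "(y, s)"] that by (simp add: x_def t_def)
  have Y0: "Y x0 t0 = - c * exp (N * e)"
    by (simp add: Y_def w_def c_def e_def algebra_simps flip: exp_add)
  have Yneg: "Y x t < - A'" "Y x t < 0"
  proof -
    have "Y x t \<le> Y x0 t0" using x0r pt by (intro min) auto
    then show "Y x t < - A'" "Y x t < 0" using Y0 N \<open>c > 0\<close> by (auto intro: order_le_less_trans)
  qed
  then have fneg: "f x t < 0" by (simp add: Y_def w_def mult_less_0_iff)
  have "t \<noteq> 0" using fneg init[OF xt(1)] by auto
  then have t: "t \<in> {0<..\<tau>}" using xt by auto
  \<comment> \<open>The minimum cannot sit on the inflow side, where the absolute value of
    \<open>Y\<close> is at most \<open>A'\<close>.\<close>
  have "x \<noteq> r"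
  proof
    assume "x = r"
    have "\<bar>Y x t\<bar> = \<bar>f x t\<bar> * w x t" by (simp add: Y_def w_def abs_mult)
    also have "\<dots> \<le> A * exp (\<bar>K + 1\<bar> * \<tau>)"
    proof (rule mult_mono)
      show "\<bar>f x t\<bar> \<le> A" "0 \<le> A" using A[OF xt] by auto
      have "- (K + 1) * t \<le> \<bar>K + 1\<bar> * t" using t by (intro mult_right_mono) auto
      also have "\<dots> \<le> \<bar>K + 1\<bar> * \<tau>" using t by (intro mult_left_mono) auto
      finally have "- (K + 1) * t - N * (M * t) \<le> \<bar>K + 1\<bar> * \<tau>"
        using \<open>N \<ge> 0\<close> \<open>0 \<le> M\<close> t
        by (smt (verit, best) greaterThanAtMost_iff mult_nonneg_nonneg)
      then show "w x t \<le> exp (\<bar>K + 1\<bar> * \<tau>)"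
        by (simp add: w_def \<open>x = r\<close>)
    qed (simp add: w_def)
    finally show False using Yneg by (simp add: A'_def)
  qed
  then have x: "x \<in> {0..<r}" using xt by auto
  define Yt where "Yt = (ft x t - (K + 1 + N * M) * f x t) * w x t"
  define Yx where "Yx = (fx x t - N * f x t) * w x t"
  have der_Yt: "((\<lambda>s. - Y x s) has_real_derivative - Yt) (at t within {0..\<tau>})"
    unfolding Y_def w_def Yt_def
    by (rule derivative_eq_intros der_t[OF x t] refl)+ (simp add: algebra_simps)
  have der_Yx: "((\<lambda>y. - Y y t) has_real_derivative - Yx) (at x within {0..r})"
    unfolding Y_def w_def Yx_def
    by (rule derivative_eq_intros der_x[OF x t] refl)+ (simp add: algebra_simps)
  have "0 \<le> - Yt"
    by (rule has_real_derivative_nonneg_if_max_left[OF der_Yt, of 0]) (use t x min in auto)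
  \<comment> \<open>At \<open>x = 0\<close> the velocity vanishes; elsewhere the minimum is interior
    in \<open>x\<close> and \<open>Yx\<close> vanishes. So the wall \<open>x = 0\<close> admits no
    inflow.\<close>
  moreover have "u x t * Yx = 0"
  proof (cases "x = 0")
    case True
    then show ?thesis using u_zero[OF t] by simp
  next
    case False
    have "0 \<le> - Yx"
      by (rule has_real_derivative_nonneg_if_max_left[OF der_Yx, of 0]) (use False t x min in auto)
    moreover have "- Yx \<le> 0"
      by (rule has_real_derivative_nonpos_if_max_right[OF der_Yx, of r]) (use t x min in auto)
    ultimately show ?thesis by simp
  qed
  ultimately have "Yt + u x t * Yx \<le> 0" by auto
  also have "Yt + u x t * Yx = (ft x t + u x t * fx x t - (K + 1 + N * (M + u x t)) * f x t) * w x t"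
    by (simp add: Yt_def Yx_def algebra_simps)
  finally have "(ft x t + u x t * fx x t - (K + 1 + N * (M + u x t)) * f x t) * w x t \<le> 0" .
  then have le: "ft x t + u x t * fx x t - (K + 1 + N * (M + u x t)) * f x t \<le> 0"
    by (simp add: w_def mult_le_0_iff)
  \<comment> \<open>The weight has raised the zeroth-order coefficient to at least 1, because
    \<open>d x t + K\<close> and \<open>M + u x t\<close> are nonnegative. With
    \<open>f x t < 0\<close> this is incompatible with the assumed inequality.\<close>
  have "0 < (d x t + K + 1 + N * (M + u x t)) * (- f x t)"
  proof (rule mult_pos_pos)
    have "0 \<le> N * (M + u x t)" using \<open>N \<ge> 0\<close> u_bound[OF x t] by (intro mult_nonneg_nonneg) auto
    then show "0 < d x t + K + 1 + N * (M + u x t)" using d_bound[OF x t] by linarith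
  qed (use fneg in simp)
  with le ineq[OF x t] show False by (simp add: algebra_simps)
qed

section \<open>Bounds and slices of continuous functions on rectangles\<close>

lemma continuous_on_rect_bounded:
  fixes f :: "real \<Rightarrow> real \<Rightarrow> real"
  assumes "continuous_on ({a..b} \<times> {c..d}) (\<lambda>(x, t). f x t)"
  obtains C where "C > 0" "\<And>x t. x \<in> {a..b} \<Longrightarrow> t \<in> {c..d} \<Longrightarrow> \<bar>f x t\<bar> \<le> C"
proof -
  have "compact ({a..b} \<times> {c..d})" by (intro compact_Times compact_Icc)
  from compact_continuous_image[OF assms this]
  have "bounded ((\<lambda>(x, t). f x t) ` ({a..b} \<times> {c..d}))" by (rule compact_imp_bounded)
  then obtain C where "C > 0" "\<forall>y \<in> (\<lambda>(x, t). f x t) ` ({a..b} \<times> {c..d}). \<bar>y\<bar> \<le> C"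
    unfolding bounded_pos by auto
  then show ?thesis by (intro that[of C]) force+
qed

lemma continuous_on_rect_slices:
  assumes "continuous_on (A \<times> B) (\<lambda>(x, t). f x t)"
  shows "t \<in> B \<Longrightarrow> continuous_on A (\<lambda>x. f x t)" and "x \<in> A \<Longrightarrow> continuous_on B (\<lambda>t. f x t)"
proof -
  show "continuous_on A (\<lambda>x. f x t)" if "t \<in> B"
    using continuous_on_compose2[OF assms, of A "\<lambda>x. (x, t)"] that
    by (fastforce intro: continuous_intros)
  show "continuous_on B (\<lambda>t. f x t)" if "x \<in> A"
    using continuous_on_compose2[OF assms, of B "\<lambda>t. (x, t)"] that
    by (fastforce intro: continuous_intros)
qed

section \<open>Flows with named derivatives and their equations up to the boundary\<close>

text \<open>The momentum equation appears in nonconservative form, with \<open>u\<close> times the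
  mass equation subtracted, and is phrased as a formula for the derivative of the pressure, since
  the sign of that derivative is what the argument exploits. The assumptions are invariant under
  \<open>x\<close> to \<open>1 - x\<close> and \<open>u\<close> to \<open>- u\<close>, so one locale
  serves both ends of the interval.\<close>

locale viscous_flow =
  fixes \<nu> \<gamma> T :: real and \<rho> \<rho>x \<rho>xx \<rho>t u ux uxx ut :: "real \<Rightarrow> real \<Rightarrow> real"
  assumes nu_pos: "\<nu> > 0" and gamma_pos: "\<gamma> > 0" and T_pos: "T > 0"
    and cont:
      "continuous_on ({0..1} \<times> {0..T}) (\<lambda>(x, t). \<rho> x t)"
      "continuous_on ({0..1} \<times> {0..T}) (\<lambda>(x, t). \<rho>x x t)"
      "continuous_on ({0..1} \<times> {0..T}) (\<lambda>(x, t). \<rho>xx x t)"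
      "continuous_on ({0..1} \<times> {0..T}) (\<lambda>(x, t). \<rho>t x t)"
      "continuous_on ({0..1} \<times> {0..T}) (\<lambda>(x, t). u x t)"
      "continuous_on ({0..1} \<times> {0..T}) (\<lambda>(x, t). ux x t)"
      "continuous_on ({0..1} \<times> {0..T}) (\<lambda>(x, t). uxx x t)"
    and der:
      "\<And>x t. x \<in> {0..1} \<Longrightarrow> t \<in> {0..T} \<Longrightarrow> ((\<lambda>y. \<rho> y t) has_real_derivative \<rho>x x t) (at x within {0..1})"
      "\<And>x t. x \<in> {0..1} \<Longrightarrow> t \<in> {0..T} \<Longrightarrow> ((\<lambda>y. \<rho>x y t) has_real_derivative \<rho>xx x t) (at x within {0..1})"
      "\<And>x t. x \<in> {0..1} \<Longrightarrow> t \<in> {0..T} \<Longrightarrow> ((\<lambda>s. \<rho> x s) has_real_derivative \<rho>t x t) (at t within {0..T})"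
      "\<And>x t. x \<in> {0..1} \<Longrightarrow> t \<in> {0..T} \<Longrightarrow> ((\<lambda>y. u y t) has_real_derivative ux x t) (at x within {0..1})"
      "\<And>x t. x \<in> {0..1} \<Longrightarrow> t \<in> {0..T} \<Longrightarrow> ((\<lambda>y. ux y t) has_real_derivative uxx x t) (at x within {0..1})"
      "\<And>x t. x \<in> {0..1} \<Longrightarrow> t \<in> {0..T} \<Longrightarrow> ((\<lambda>s. u x s) has_real_derivative ut x t) (at t within {0..T})"
    and mass: "\<And>x t. x \<in> {0<..<1} \<Longrightarrow> t \<in> {0<..T} \<Longrightarrow>
      \<rho>t x t + \<rho>x x t * u x t + \<rho> x t * ux x t = 0"
    and momentum: "\<And>x t. x \<in> {0<..<1} \<Longrightarrow> t \<in> {0<..T} \<Longrightarrow>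
      ((\<lambda>y. \<rho> y t powr \<gamma>) has_real_derivative
        \<nu> * uxx x t - \<rho> x t * (ut x t + u x t * ux x t)) (at x)"
    and boundary: "\<And>t. t \<in> {0<..T} \<Longrightarrow> u 0 t = 0" "\<And>t. t \<in> {0<..T} \<Longrightarrow> u 1 t = 0"
      "\<And>t. t \<in> {0<..T} \<Longrightarrow> ux 0 t = 0" "\<And>t. t \<in> {0<..T} \<Longrightarrow> ux 1 t = 0"
begin

text \<open>The boundary condition is imposed for positive times; continuity in time supplies the
  corner \<open>(0, 0)\<close>, where a maximum over the closed rectangle might lie.\<close>

lemma u_left: "t \<in> {0..T} \<Longrightarrow> u 0 t = 0"
proof (rule continuous_constant_on_closure[of "{0<..T}" "\<lambda>t. u 0 t"])
  show "continuous_on (closure {0<..T}) (\<lambda>t. u 0 t)"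
    using continuous_on_rect_slices(2)[OF cont(5), of 0] T_pos
    by (simp add: closure_greaterThanAtMost)
qed (use T_pos boundary in \<open>auto simp: closure_greaterThanAtMost\<close>)

text \<open>Both sides are continuous on the closed rectangle and agree on a dense subset. The
  extension to \<open>x = 0\<close> and \<open>t = 0\<close> is what permits transport along the
  wall and integration from time 0.\<close>

lemma mass_closed:
  assumes "x \<in> {0..1}" "t \<in> {0..T}"
  shows "\<rho>t x t = - (\<rho>x x t * u x t + \<rho> x t * ux x t)"
proof -
  have cl: "closure ({0<..<1::real} \<times> {0<..T}) = {0..1} \<times> {0..T}"
    using T_pos by (simp add: closure_Times closure_greaterThanAtMost)
  have "(\<lambda>(x, t). \<rho>t x t + \<rho>x x t * u x t + \<rho> x t * ux x t) (x, t) = 0"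
  proof (rule continuous_constant_on_closure[of "{0<..<1} \<times> {0<..T}"], unfold cl)
    show "continuous_on ({0..1} \<times> {0..T}) (\<lambda>(x, t). \<rho>t x t + \<rho>x x t * u x t + \<rho> x t * ux x t)"
      using cont unfolding split_beta by (intro continuous_intros) auto
  qed (use assms mass in auto)
  then show ?thesis by simp
qed

text \<open>The regularity class does not provide this mixed derivative. However, the mass equation
  expresses \<open>\<rho>t\<close> through quantities that are differentiable in \<open>x\<close>.
  Writing \<open>\<rho>\<close> as its initial value plus the time integral of
  \<open>\<rho>t\<close>, differentiating under the integral sign and then applying the fundamental
  theorem of calculus in time yields it.\<close>

lemma density_x_time_derivative:
  assumes x: "x \<in> {0..1}" and t: "t \<in> {0..T}"
  shows "((\<lambda>s. \<rho>x x s) has_real_derivative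
    - (\<rho>xx x t * u x t + 2 * \<rho>x x t * ux x t + \<rho> x t * uxx x t)) (at t within {0..T})"
proof -
  define G where "G x t = - (\<rho>xx x t * u x t + 2 * \<rho>x x t * ux x t + \<rho> x t * uxx x t)" for x t
  have cont_G: "continuous_on ({0..1} \<times> {0..T}) (\<lambda>(x, t). G x t)"
    using cont unfolding split_beta G_def by (intro continuous_intros) auto
  have der_rho_t: "((\<lambda>y. \<rho>t y s) has_real_derivative G y s) (at y within {0..1})"
    if "y \<in> {0..1}" "s \<in> {0..T}" for y s
  proof (rule has_field_derivative_transform_within[OF _ zero_less_one that(1)])
    show "((\<lambda>y. - (\<rho>x y s * u y s + \<rho> y s * ux y s)) has_real_derivative G y s) (at y within {0..1})"
      unfolding G_def
      by (rule derivative_eq_intros der that refl)+ (simp add: algebra_simps)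
  qed (use that mass_closed in auto)
  have integral_G: "\<rho>x x s = \<rho>x x 0 + integral {0..s} (G x)" if s: "s \<in> {0..T}" for s
  proof -
    have ftc: "(\<rho>t y has_integral \<rho> y s - \<rho> y 0) {0..s}" if "y \<in> {0..1}" for y
    proof (rule fundamental_theorem_of_calculus)
      fix r assume "r \<in> {0..s}"
      then show "(\<rho> y has_vector_derivative \<rho>t y r) (at r within {0..s})"
        using DERIV_subset[OF der(3)[OF that, of r], of "{0..s}"] s
        by (simp add: has_real_derivative_iff_has_vector_derivative)
    qed (use s in simp)
    have leibniz: "((\<lambda>y. integral (cbox 0 s) (\<rho>t y)) has_real_derivative integral (cbox 0 s) (G x))
        (at x within {0..1})"
    proof (rule leibniz_rule_field_derivative)
      show "continuous_on ({0..1} \<times> cbox 0 s) (\<lambda>(x, t). G x t)"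
        by (rule continuous_on_subset[OF cont_G]) (use s in auto)
    qed (use s x der_rho_t ftc in \<open>auto simp: integrable_on_def\<close>)
    have "((\<lambda>y. \<rho> y s) has_real_derivative \<rho>x x 0 + integral {0..s} (G x)) (at x within {0..1})"
    proof (rule has_field_derivative_transform_within[OF _ zero_less_one x])
      show "((\<lambda>y. \<rho> y 0 + integral (cbox 0 s) (\<rho>t y)) has_real_derivative
          \<rho>x x 0 + integral {0..s} (G x)) (at x within {0..1})"
        using DERIV_add[OF der(1)[OF x, of 0] leibniz] T_pos by simp
    next
      fix y :: real assume "y \<in> {0..1}"
      then show "\<rho> y 0 + integral (cbox 0 s) (\<rho>t y) = \<rho> y s"
        using integral_unique[OF ftc] by simp
    qed
    with der(1)[OF x s] show ?thesis
      by (rule has_field_derivative_unique)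
        (use x in \<open>auto simp: trivial_limit_within islimpt_Icc\<close>)
  qed
  have "((\<lambda>s. \<rho>x x 0 + integral {0..s} (G x)) has_real_derivative G x t) (at t within {0..T})"
    using DERIV_add[OF DERIV_const[of "\<rho>x x 0"]
        integral_has_real_derivative[OF continuous_on_rect_slices(2)[OF cont_G x] t]] by simp
  then have "((\<lambda>s. \<rho>x x s) has_real_derivative G x t) (at t within {0..T})"
    by (rule has_field_derivative_transform_within[OF _ zero_less_one t]) (rule integral_G[symmetric])
  then show ?thesis by (simp add: G_def)
qed

text \<open>The density increases up to \<open>x\<close>, hence so does the pressure, whose
  derivative at \<open>x\<close> is therefore nonnegative. Comparing pressure values directly avoids
  differentiating \<open>powr\<close> where the density may vanish.\<close>

lemma pressure_monotone_momentum:
  assumes rho: "\<And>y. y \<in> {0..x} \<Longrightarrow> 0 \<le> \<rho> y t" and rho_x: "\<And>y. y \<in> {0..x} \<Longrightarrow> 0 \<le> \<rho>x y t"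
    and x: "x \<in> {0<..<1}" and t: "t \<in> {0<..T}"
  shows "\<rho> x t * (ut x t + u x t * ux x t) \<le> \<nu> * uxx x t"
proof -
  have "0 \<le> \<nu> * uxx x t - \<rho> x t * (ut x t + u x t * ux x t)"
  proof (rule has_real_derivative_nonneg_if_max_left[OF momentum[OF x t], of "x / 2"])
    fix s assume s: "s \<in> {x / 2..x}"
    have "\<rho> s t \<le> \<rho> x t"
    proof (rule DERIV_nonneg_imp_nondecreasing[where f = "\<lambda>y. \<rho> y t"])
      fix y assume y: "s \<le> y" "y \<le> x"
      then have "((\<lambda>y. \<rho> y t) has_real_derivative \<rho>x y t) (at y)"
        using der(1)[of y t] s x t at_within_Icc_at[of 0 y 1] by auto
      then show "\<exists>d. ((\<lambda>y. \<rho> y t) has_real_derivative d) (at y) \<and> 0 \<le> d"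
        using rho_x[of y] y s x by auto
    qed (use s in simp)
    then show "\<rho> s t powr \<gamma> \<le> \<rho> x t powr \<gamma>"
      using rho[of s] s x gamma_pos by (intro powr_mono2) auto
  qed (use x in auto)
  then show ?thesis by simp
qed

section \<open>Persistence of the signs of the density and of its slope\<close>

text \<open>The mass equation is a transport equation for \<open>\<rho>\<close> with zeroth-order
  coefficient \<open>ux\<close>, so \<open>transport_nonneg\<close> applies with
  \<open>r = 1\<close>.\<close>

lemma density_nonneg:
  assumes init: "\<And>x. x \<in> {0..1} \<Longrightarrow> 0 \<le> \<rho> x 0"
    and u_bound: "\<And>x t. x \<in> {0..1} \<Longrightarrow> t \<in> {0..T} \<Longrightarrow> \<bar>u x t\<bar> \<le> M"
    and "0 \<le> x" "x + M * t < 1" "t \<in> {0..T}"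
  shows "0 \<le> \<rho> x t"
proof -
  obtain K where K: "\<And>x t. x \<in> {0..1} \<Longrightarrow> t \<in> {0..T} \<Longrightarrow> \<bar>ux x t\<bar> \<le> K"
    using continuous_on_rect_bounded[OF cont(6)] by metis
  have "0 \<le> M" using u_bound[of 0 0] T_pos by auto
  show ?thesis
  proof (rule transport_nonneg[OF cont(1) der(3) der(1) u_bound K])
    fix x t :: real assume "x \<in> {0..<1}" "t \<in> {0<..T}"
    then show "0 \<le> \<rho>t x t + u x t * \<rho>x x t + ux x t * \<rho> x t"
      using mass_closed[of x t] by simp
  qed (use assms \<open>0 \<le> M\<close> boundary in auto)
qed

text \<open>Subtracting \<open>(l - B * t) * \<rho>\<close> instead of \<open>l * \<rho>\<close> produces the term \<open>B * \<rho>\<close>, which absorbs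
  the forcing \<open>\<rho> * uxx\<close> in the transport equation for \<open>\<rho>x\<close>.\<close>

lemma density_x_nonneg:
  assumes l: "l > 0" and r: "r \<in> {0<..<1}"
    and u_bound: "\<And>x t. x \<in> {0..1} \<Longrightarrow> t \<in> {0..T} \<Longrightarrow> \<bar>u x t\<bar> \<le> M"
    and ux_bound: "\<And>x t. x \<in> {0..1} \<Longrightarrow> t \<in> {0..T} \<Longrightarrow> \<bar>ux x t\<bar> \<le> K"
    and uxx_bound: "\<And>x t. x \<in> {0..1} \<Longrightarrow> t \<in> {0..T} \<Longrightarrow> \<bar>uxx x t\<bar> \<le> K'"
    and tau: "0 < \<tau>" "\<tau> \<le> T" "(K' + l * K) * \<tau> \<le> l"
    and rho: "\<And>x t. x \<in> {0..r} \<Longrightarrow> t \<in> {0..\<tau>} \<Longrightarrow> 0 \<le> \<rho> x t"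
    and slope: "\<And>x. x \<in> {0..r} \<Longrightarrow> l * \<rho> x 0 \<le> \<rho>x x 0"
    and pt: "0 \<le> x0" "x0 + M * t0 < r" "t0 \<in> {0..\<tau>}"
  shows "0 \<le> \<rho>x x0 t0"
proof -
  define B where "B = K' + l * K"
  have "0 \<le> M" "0 \<le> K" "0 \<le> K'"
    using u_bound[of 0 0] ux_bound[of 0 0] uxx_bound[of 0 0] T_pos by auto
  then have "0 \<le> B" using l by (simp add: B_def)
  \<comment> \<open>The smallness condition on \<open>\<tau>\<close> says
    \<open>B * \<tau> \<le> l\<close>, so the time-dependent slope decreases from \<open>l\<close>
    without becoming negative before \<open>\<tau>\<close>.\<close>
  have theta: "0 \<le> l - B * t" "l - B * t \<le> l" if "t \<in> {0..\<tau>}" for t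
  proof -
    have "B * t \<le> B * \<tau>" using that \<open>0 \<le> B\<close> by (intro mult_left_mono) auto
    then show "0 \<le> l - B * t" using tau by (simp add: B_def)
    show "l - B * t \<le> l" using that \<open>0 \<le> B\<close> by simp
  qed
  define z where "z x t = \<rho>x x t - (l - B * t) * \<rho> x t" for x t
  define zt where "zt x t = - (\<rho>xx x t * u x t + 2 * \<rho>x x t * ux x t + \<rho> x t * uxx x t)
    + B * \<rho> x t - (l - B * t) * \<rho>t x t" for x t
  define zx where "zx x t = \<rho>xx x t - (l - B * t) * \<rho>x x t" for x t
  have "0 \<le> z x0 t0"
  proof (rule transport_nonneg[where f = z and r = r and \<tau> = \<tau> and M = M and u = u and K = "2 * K"
        and d = "\<lambda>x t. 2 * ux x t" and ft = zt and fx = zx])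
    show "continuous_on ({0..r} \<times> {0..\<tau>}) (\<lambda>(x, t). z x t)"
    proof (rule continuous_on_subset)
      show "continuous_on ({0..1} \<times> {0..T}) (\<lambda>(x, t). z x t)"
        using cont unfolding split_beta z_def by (intro continuous_intros) auto
    qed (use r tau in auto)
  next
    fix x t assume xt: "x \<in> {0..<r}" "t \<in> {0<..\<tau>}"
    then have xt': "x \<in> {0..1}" "t \<in> {0..T}" "t \<in> {0..\<tau>}" "x \<in> {0..r}" using r tau by auto
    have "((\<lambda>s. z x s) has_real_derivative zt x t) (at t within {0..T})"
      unfolding z_def zt_def
      by (rule derivative_eq_intros density_x_time_derivative der xt' refl)+ simp
    then show "((\<lambda>s. z x s) has_real_derivative zt x t) (at t within {0..\<tau>})"
      by (rule DERIV_subset) (use tau in auto)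
    have "((\<lambda>y. z y t) has_real_derivative zx x t) (at x within {0..1})"
      unfolding z_def zx_def
      by (rule derivative_eq_intros der xt' refl)+ simp
    then show "((\<lambda>y. z y t) has_real_derivative zx x t) (at x within {0..r})"
      by (rule DERIV_subset) (use r in auto)
    show "\<bar>u x t\<bar> \<le> M" "\<bar>2 * ux x t\<bar> \<le> 2 * K"
      using u_bound[OF xt'(1,2)] ux_bound[OF xt'(1,2)] by auto
    have "(l - B * t) * ux x t \<le> \<bar>l - B * t\<bar> * \<bar>ux x t\<bar>"
      by (metis abs_ge_self abs_mult)
    also have "\<dots> \<le> l * K"
      using theta[OF xt'(3)] ux_bound[OF xt'(1,2)] l by (intro mult_mono) auto
    finally have "0 \<le> B - uxx x t - (l - B * t) * ux x t"
      using uxx_bound[OF xt'(1,2)] by (simp add: B_def)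
    \<comment> \<open>After \<open>\<rho>t\<close> is eliminated by the mass equation, all terms
      with \<open>\<rho>x\<close> and \<open>\<rho>xx\<close> cancel, and what remains is a multiple
      of \<open>\<rho>\<close> that \<open>B\<close> makes nonnegative.\<close>
    then have "0 \<le> \<rho> x t * (B - uxx x t - (l - B * t) * ux x t)"
      using rho[OF xt'(4,3)] by simp
    also have "\<dots> = zt x t + u x t * zx x t + 2 * ux x t * z x t"
      by (simp add: zt_def zx_def z_def mass_closed[OF xt'(1,2)] algebra_simps)
    finally show "0 \<le> zt x t + u x t * zx x t + 2 * ux x t * z x t" .
  next
    fix t assume "t \<in> {0<..\<tau>}"
    then show "u 0 t = 0" using boundary(1)[of t] tau by simp
  next
    fix x assume "x \<in> {0..r}"
    then show "0 \<le> z x 0" using slope[of x] by (simp add: z_def)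
  qed (use pt \<open>0 \<le> M\<close> in auto)
  moreover have "0 \<le> (l - B * t0) * \<rho> x0 t0"
  proof (rule mult_nonneg_nonneg[OF theta(1)[OF pt(3)] rho[OF _ pt(3)]])
    have "0 \<le> M * t0" using \<open>0 \<le> M\<close> pt(3) by auto
    then show "x0 \<in> {0..r}" using pt by auto
  qed
  ultimately show ?thesis by (simp add: z_def)
qed

section \<open>Comparison of the velocity with a travelling wave\<close>

text \<open>The barrier \<open>exp (k * (x - a + c * t)) - 1\<close> is a wave moving to the left with speed
  \<open>c = a / \<tau>\<close>: it is positive only to the right of its front, which starts at \<open>a\<close> and reaches
  \<open>x = 0\<close> exactly at time \<open>\<tau>\<close>. Large \<open>k\<close> makes it a strict subsolution however large \<open>c\<close> is.\<close>

lemma velocity_below_wave: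
  assumes a: "0 < a" "a < b" and b: "b < 1" and tau: "0 < \<tau>" "\<tau> \<le> T"
    and rho: "\<And>x t. x \<in> {0..b} \<Longrightarrow> t \<in> {0..\<tau>} \<Longrightarrow> 0 \<le> \<rho> x t"
    and rho_x: "\<And>x t. x \<in> {0..b} \<Longrightarrow> t \<in> {0..\<tau>} \<Longrightarrow> 0 \<le> \<rho>x x t"
    and u_init: "\<And>x. x \<in> {0<..<b} \<Longrightarrow> u x 0 \<le> 0"
    and "\<eta> > 0"
    and u_neg: "\<And>x t. x \<in> {a..b} \<Longrightarrow> t \<in> {0..\<tau>} \<Longrightarrow> u x t \<le> - \<eta>"
  obtains k \<epsilon> where "k > 0" "\<epsilon> > 0" "\<And>x. x \<in> {0..b} \<Longrightarrow> u x \<tau> + \<epsilon> * (exp (k * x) - 1) \<le> 0"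
proof -
  obtain M where "M > 0" and M: "\<And>x t. x \<in> {0..1} \<Longrightarrow> t \<in> {0..T} \<Longrightarrow> \<bar>u x t\<bar> \<le> M"
    using continuous_on_rect_bounded[OF cont(5)] by metis
  obtain R where "R > 0" and R: "\<And>x t. x \<in> {0..1} \<Longrightarrow> t \<in> {0..T} \<Longrightarrow> \<bar>\<rho> x t\<bar> \<le> R"
    using continuous_on_rect_bounded[OF cont(1)] by metis
  define c where "c = a / \<tau>"
  have "c > 0" "c * \<tau> = a" using a tau by (auto simp: c_def)
  \<comment> \<open>Chosen so that \<open>\<nu> * k\<close> exceeds \<open>R * (c + M)\<close> by
    \<open>\<nu>\<close>: diffusion then beats inertia for densities up to \<open>R\<close> and
    velocities up to \<open>M\<close>.\<close>
  define k where "k = R * (c + M) / \<nu> + 1"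
  have "R * (c + M) / \<nu> > 0" using \<open>R > 0\<close> \<open>c > 0\<close> \<open>M > 0\<close> nu_pos by simp
  then have "k > 0" by (simp add: k_def)
  have k: "\<nu> * k > R * (c + M)" using nu_pos by (simp add: k_def field_simps)
  \<comment> \<open>As \<open>c * t \<le> a\<close>, the exponent of \<open>E\<close> is at most
    \<open>k * b\<close> on the strip from \<open>a\<close> to \<open>b\<close>; this amplitude
    keeps the wave below \<open>\<eta>\<close> there.\<close>
  define \<epsilon> where "\<epsilon> = \<eta> * exp (- k * b)"
  have "\<epsilon> > 0" using \<open>\<eta> > 0\<close> by (simp add: \<epsilon>_def)
  define E where "E x t = exp (k * (x - a + c * t))" for x t
  have E_pos: "E x t > 0" for x t by (simp add: E_def)
  define w where "w x t = u x t + \<epsilon> * (E x t - 1)" for x t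
  have front: "c * t \<le> a" if "t \<in> {0..\<tau>}" for t
  proof -
    have "c * t \<le> c * \<tau>" using that \<open>c > 0\<close> by (intro mult_left_mono) auto
    then show ?thesis using \<open>c * \<tau> = a\<close> by simp
  qed
  have w_right: "w x t \<le> 0" if "x \<in> {a..b}" "t \<in> {0..\<tau>}" for x t
  proof -
    have "\<epsilon> * E x t \<le> \<epsilon> * exp (k * b)"
      using \<open>\<epsilon> > 0\<close> \<open>k > 0\<close> that front[OF that(2)] by (simp add: E_def)
    also have "\<dots> = \<eta>" by (simp add: \<epsilon>_def flip: exp_add)
    finally show ?thesis using u_neg[OF that] \<open>\<epsilon> > 0\<close> by (simp add: w_def algebra_simps)
  qed
  have behind: "w x t \<le> u x t" if "x - a + c * t \<le> 0" for x t
    using that \<open>\<epsilon> > 0\<close> \<open>k > 0\<close> by (simp add: w_def E_def mult_le_0_iff)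
  have "continuous_on ({0..1} \<times> {0..T}) (\<lambda>p. w (fst p) (snd p))"
    using cont unfolding w_def E_def split_beta by (intro continuous_intros) auto
  then have "continuous_on ({0..b} \<times> {0..\<tau>}) (\<lambda>p. w (fst p) (snd p))"
    by (rule continuous_on_subset) (use b tau in auto)
  from continuous_attains_sup[OF compact_Times[OF compact_Icc compact_Icc] _ this] a tau
  obtain p where p: "p \<in> {0..b} \<times> {0..\<tau>}"
      "\<forall>q \<in> {0..b} \<times> {0..\<tau>}. w (fst q) (snd q) \<le> w (fst p) (snd p)"
    by fastforce
  define x t where "x = fst p" and "t = snd p"
  have xt: "x \<in> {0..b}" "t \<in> {0..\<tau>}" using p by (auto simp: x_def t_def mem_Times_iff)
  have max: "w y s \<le> w x t" if "y \<in> {0..b}" "s \<in> {0..\<tau>}" for y s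
    using p(2)[rule_format, of "(y, s)"] that by (simp add: x_def t_def)
  have "w x t \<le> 0"
  proof (rule ccontr)
    assume pos: "\<not> w x t \<le> 0"
    \<comment> \<open>A positive maximum avoids the strip on the right, the wall (which the front
      has not passed) and the initial time (when the front is at \<open>a\<close>). It is thus
      interior in space, but possibly at the final time \<open>\<tau>\<close>.\<close>
    have "x < a" using pos w_right[of x t] xt by force
    have "x \<noteq> 0" using pos behind[of 0 t] front[OF xt(2)] u_left[of t] xt tau by auto
    have x: "x \<in> {0<..<b}" "x \<in> {0<..<1}" "x \<in> {0..1}" using xt \<open>x < a\<close> \<open>x \<noteq> 0\<close> a b by auto
    have "t \<noteq> 0" using pos behind[of x 0] u_init[OF x(1)] \<open>x < a\<close> by auto
    then have t: "t \<in> {0<..T}" "t \<in> {0..T}" "0 < t" using xt tau by auto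
    define wx where "wx y = ux y t + \<epsilon> * (k * E y t)" for y
    have u_x: "((\<lambda>y. u y t) has_real_derivative ux y t) (at y)" if "y \<in> {0<..<b}" for y
      using der(4)[of y t] that b t at_within_Icc_at[of 0 y 1] by auto
    have u_xx: "((\<lambda>y. ux y t) has_real_derivative uxx x t) (at x)"
      using der(5)[of x t] x t at_within_Icc_at[of 0 x 1] by auto
    have w_x: "((\<lambda>y. w y t) has_real_derivative wx y) (at y)" if "y \<in> {0<..<b}" for y
      unfolding w_def wx_def E_def
      by (rule derivative_eq_intros u_x that refl)+ simp
    have w_xx: "(wx has_real_derivative uxx x t + \<epsilon> * (k * (k * E x t))) (at x)"
      unfolding wx_def E_def
      by (rule derivative_eq_intros u_xx refl)+ simp
    have w_t: "((\<lambda>s. w x s) has_real_derivative ut x t + \<epsilon> * (k * c * E x t)) (at t within {0..T})"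
      unfolding w_def E_def
      by (rule derivative_eq_intros der(6) x t refl)+ simp
    have space: "wx x = 0" "uxx x t + \<epsilon> * (k * (k * E x t)) \<le> 0"
      by (rule second_derivative_nonpos_at_max[OF w_x w_xx x(1)]; use max xt in auto)+
    have time: "0 \<le> ut x t + \<epsilon> * (k * c * E x t)"
      by (rule has_real_derivative_nonneg_if_max_left[OF w_t t(3)]) (use max xt t in auto)
    have "\<rho> x t * (ut x t + u x t * ux x t) \<le> \<nu> * uxx x t"
      by (rule pressure_monotone_momentum) (use rho rho_x x xt t in auto)
    also have "\<dots> \<le> \<nu> * (- (\<epsilon> * (k * (k * E x t))))"
      using space(2) nu_pos by (intro mult_left_mono) auto
    also have "\<dots> = - (\<nu> * k) * (\<epsilon> * k * E x t)" by simp
    also have "\<dots> < - (R * (c + M)) * (\<epsilon> * k * E x t)"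
      using k \<open>\<epsilon> > 0\<close> \<open>k > 0\<close> E_pos[of x t] by (intro mult_strict_right_mono) auto
    finally have upper: "\<rho> x t * (ut x t + u x t * ux x t) < - (R * (c + M)) * (\<epsilon> * k * E x t)" .
    have ux_eq: "ux x t = - (\<epsilon> * k * E x t)" using space(1) by (simp add: wx_def)
    \<comment> \<open>The maximum gives \<open>ux x t = - (\<epsilon> * k * E x t)\<close> and
      \<open>ut x t \<ge> - (\<epsilon> * k * c * E x t)\<close>. Hence the inertial term is at
      least \<open>- \<rho> x t * (c + u x t) * (\<epsilon> * k * E x t)\<close>, and this bound
      contradicts \<open>upper\<close>.\<close>
    have "\<rho> x t * (c + u x t) \<le> R * (c + M)"
      using rho[OF xt] R[OF x(3) t(2)] M[OF x(3) t(2)] \<open>c > 0\<close> \<open>M > 0\<close> \<open>R > 0\<close>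
      by (smt (verit) mult_left_mono mult_right_mono)
    then have "\<rho> x t * (c + u x t) * (\<epsilon> * k * E x t) \<le> R * (c + M) * (\<epsilon> * k * E x t)"
      using \<open>\<epsilon> > 0\<close> \<open>k > 0\<close> E_pos[of x t] by (intro mult_right_mono) auto
    moreover have "0 \<le> \<rho> x t * (ut x t + \<epsilon> * (k * c * E x t))"
      using time rho[OF xt] by simp
    ultimately show False using upper by (simp add: ux_eq algebra_simps)
  qed
  have "u y \<tau> + \<epsilon> * (exp (k * y) - 1) \<le> 0" if "y \<in> {0..b}" for y
    using max[OF that, of \<tau>] \<open>w x t \<le> 0\<close> tau \<open>c * \<tau> = a\<close> by (simp add: w_def E_def)
  with \<open>k > 0\<close> \<open>\<epsilon> > 0\<close> show ?thesis using that by blast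
qed

section \<open>Contradiction at the left wall\<close>

text \<open>The regions are nested: for a short time \<open>\<rho>\<close> is nonnegative on
  \<open>{0..r}\<close>, \<open>\<rho>x\<close> is nonnegative on
  \<open>{0..r - \<delta> / 2}\<close>, and \<open>u\<close> stays below a negative constant on the
  strip from \<open>r - \<delta>\<close> to \<open>r - \<delta> / 2\<close>. A wave started at
  \<open>r - \<delta>\<close> then forces a negative slope of \<open>u\<close> at the wall at time
  \<open>\<tau>\<close>.\<close>

lemma not_inward_at_left:
  assumes "l > 0" and r: "r \<in> {0<..<1}"
    and rho_init: "\<And>x. x \<in> {0<..<1} \<Longrightarrow> 0 \<le> \<rho> x 0"
    and slope: "\<And>x. x \<in> {0<..<r} \<Longrightarrow> l * \<rho> x 0 \<le> \<rho>x x 0"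
    and u_init: "\<And>x. x \<in> {0<..<r} \<Longrightarrow> u x 0 \<le> 0" and u_r: "u r 0 < 0"
  shows False
proof -
  obtain M where "M > 0" and M: "\<And>x t. x \<in> {0..1} \<Longrightarrow> t \<in> {0..T} \<Longrightarrow> \<bar>u x t\<bar> \<le> M"
    using continuous_on_rect_bounded[OF cont(5)] by metis
  obtain K where "K > 0" and K: "\<And>x t. x \<in> {0..1} \<Longrightarrow> t \<in> {0..T} \<Longrightarrow> \<bar>ux x t\<bar> \<le> K"
    using continuous_on_rect_bounded[OF cont(6)] by metis
  obtain K' where "K' > 0" and K': "\<And>x t. x \<in> {0..1} \<Longrightarrow> t \<in> {0..T} \<Longrightarrow> \<bar>uxx x t\<bar> \<le> K'"
    using continuous_on_rect_bounded[OF cont(7)] by metis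
  note slices = cont(1,2)[THEN continuous_on_rect_slices(1), of 0]
  have rho_init': "0 \<le> \<rho> x 0" if "x \<in> {0..1}" for x
    by (rule continuous_ge_on_closure[of "{0<..<1}" "\<lambda>x. \<rho> x 0"])
      (use that rho_init slices T_pos in auto)
  have slope': "l * \<rho> x 0 \<le> \<rho>x x 0" if "x \<in> {0..r}" for x
  proof -
    have "continuous_on {0..r} (\<lambda>x. \<rho>x x 0 - l * \<rho> x 0)"
      using slices T_pos r by (intro continuous_intros) (auto elim!: continuous_on_subset)
    then have cont_diff: "continuous_on (closure {0<..<r}) (\<lambda>x. \<rho>x x 0 - l * \<rho> x 0)"
      using r by simp
    have "0 \<le> \<rho>x x 0 - l * \<rho> x 0"
      by (rule continuous_ge_on_closure[OF cont_diff]) (use that slope r in auto)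
    then show ?thesis by simp
  qed
  define \<eta> where "\<eta> = - u r 0 / 2"
  have "\<eta> > 0" using u_r by (simp add: \<eta>_def)
  have "(r, 0) \<in> {0..1} \<times> {0..T}" using r T_pos by auto
  with \<open>\<eta> > 0\<close> obtain d where "d > 0" and d: "\<forall>p \<in> {0..1} \<times> {0..T}. dist p (r, 0) < d \<longrightarrow>
      dist ((\<lambda>(x, t). u x t) p) ((\<lambda>(x, t). u x t) (r, 0)) < \<eta>"
    using cont(5)[unfolded continuous_on_iff] by blast
  define \<delta> where "\<delta> = min (d / 2) (r / 2)"
  have \<delta>: "0 < \<delta>" "\<delta> \<le> d / 2" "\<delta> < r"
    using \<open>d > 0\<close> r by (auto simp: \<delta>_def min_def)
  define L where "L = K' + l * K"
  have "L > 0" using \<open>K' > 0\<close> \<open>l > 0\<close> \<open>K > 0\<close> by (simp add: L_def add_pos_pos)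
  \<comment> \<open>Apart from \<open>T\<close>, the bounds serve in turn to keep the strip within
    distance \<open>d\<close> of \<open>(r, 0)\<close>, to limit the travel
    \<open>M * \<tau>\<close> to less than \<open>\<delta> / 2\<close> and to less than
    \<open>1 - r\<close>, and to meet the time restriction of
    \<open>density_x_nonneg\<close>.\<close>
  define \<tau> where "\<tau> = min (min T (d / 4)) (min (\<delta> / (4 * M)) (min ((1 - r) / (2 * M)) (l / L)))"
  have "0 < \<tau>"
    using T_pos \<open>d > 0\<close> \<open>M > 0\<close> \<open>l > 0\<close> \<open>L > 0\<close> \<delta> r by (simp add: \<tau>_def)
  moreover have "\<tau> \<le> T" "\<tau> \<le> d / 4" unfolding \<tau>_def by linarith+
  ultimately have tau: "0 < \<tau>" "\<tau> \<le> T" "\<tau> < d / 2" using \<open>d > 0\<close> by auto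
  have "\<tau> \<le> \<delta> / (4 * M)" "\<tau> \<le> (1 - r) / (2 * M)" "\<tau> \<le> l / L" by (simp_all add: \<tau>_def)
  then have "M * \<tau> * 4 \<le> \<delta>" "M * \<tau> * 2 \<le> 1 - r" and L_tau: "L * \<tau> \<le> l"
    using \<open>M > 0\<close> \<open>L > 0\<close> by (auto simp: field_simps)
  then have M_tau: "M * \<tau> < \<delta> / 2" "r + M * \<tau> < 1" using \<delta> r by auto
  have M_t: "M * t \<le> M * \<tau>" if "t \<in> {0..\<tau>}" for t
    using that \<open>M > 0\<close> by (intro mult_left_mono) auto
  have rho: "0 \<le> \<rho> x t" if "x \<in> {0..r}" "t \<in> {0..\<tau>}" for x t
    by (rule density_nonneg[OF rho_init' M]) (use that M_t[OF that(2)] M_tau tau in auto)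
  have rho_x: "0 \<le> \<rho>x x t" if "x \<in> {0..r - \<delta> / 2}" "t \<in> {0..\<tau>}" for x t
    by (rule density_x_nonneg[OF \<open>l > 0\<close> r M K K' tau(1,2) L_tau[unfolded L_def] rho slope'])
      (use that M_t[OF that(2)] M_tau in auto)
  have u_neg: "u x t \<le> - \<eta>" if "x \<in> {r - \<delta>..r - \<delta> / 2}" "t \<in> {0..\<tau>}" for x t
  proof -
    have "dist (x, t) (r, 0) \<le> dist x r + dist t 0"
        unfolding dist_Pair_Pair by (rule sqrt_sum_squares_le_sum) auto
    also have "\<dots> < d" using that \<delta> tau by (auto simp: dist_real_def)
    finally have "dist (u x t) (u r 0) < \<eta>"
      using bspec[OF d, of "(x, t)"] that \<delta> tau r by auto
    then show ?thesis by (auto simp: dist_real_def \<eta>_def)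
  qed
  obtain k \<epsilon> where "k > 0" "\<epsilon> > 0"
    and below: "\<And>x. x \<in> {0..r - \<delta> / 2} \<Longrightarrow> u x \<tau> + \<epsilon> * (exp (k * x) - 1) \<le> 0"
    by (rule velocity_below_wave[of "r - \<delta>" "r - \<delta> / 2" \<tau> \<eta>])
      (use \<delta> r tau rho rho_x u_init \<open>\<eta> > 0\<close> u_neg in auto)
  have u0: "u 0 \<tau> = 0" "ux 0 \<tau> = 0" using boundary tau by auto
  have u_der: "((\<lambda>y. u y \<tau>) has_real_derivative ux 0 \<tau>) (at 0 within {0..1})"
    by (rule der(4)) (use tau in auto)
  \<comment> \<open>This function vanishes at 0 and is nonpositive to the right, so its slope at 0
    cannot be positive; but \<open>ux 0 \<tau> = 0\<close> leaves exactly
    \<open>\<epsilon> * k\<close>.\<close>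
  have "((\<lambda>y. u y \<tau> + \<epsilon> * (exp (k * y) - 1)) has_real_derivative \<epsilon> * k) (at 0 within {0..1})"
    by (rule derivative_eq_intros u_der refl)+ (simp add: u0)
  then have "\<epsilon> * k \<le> 0"
    by (rule has_real_derivative_nonpos_if_max_right[of _ _ _ _ "r - \<delta> / 2"])
      (use below u0 \<delta> r in auto)
  with \<open>k > 0\<close> \<open>\<epsilon> > 0\<close> show False by (simp add: mult_le_0_iff)
qed

section \<open>Reflection of the interval\<close>

text \<open>Each \<open>x\<close>-derivative contributes one sign and so does the velocity; hence
  \<open>\<rho>x\<close>, \<open>u\<close>, \<open>uxx\<close> and \<open>ut\<close> change sign,
  while \<open>\<rho>xx\<close>, \<open>\<rho>t\<close> and \<open>ux\<close> keep theirs.\<close>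

lemma reflect:
  "viscous_flow \<nu> \<gamma> T (\<lambda>x t. \<rho> (1 - x) t) (\<lambda>x t. - \<rho>x (1 - x) t) (\<lambda>x t. \<rho>xx (1 - x) t)
    (\<lambda>x t. \<rho>t (1 - x) t) (\<lambda>x t. - u (1 - x) t) (\<lambda>x t. ux (1 - x) t) (\<lambda>x t. - uxx (1 - x) t)
    (\<lambda>x t. - ut (1 - x) t)"
proof -
  have cont': "continuous_on ({0..1} \<times> {0..T}) (\<lambda>(x, t). f (1 - x) t)"
    if "continuous_on ({0..1} \<times> {0..T}) (\<lambda>(x, t). f x t)" for f :: "real \<Rightarrow> real \<Rightarrow> real"
  proof -
    have "continuous_on ({0..1} \<times> {0..T}) (\<lambda>p. case (1 - fst p, snd p) of (x, t) \<Rightarrow> f x t)"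
      by (rule continuous_on_compose2[OF that]) (auto intro!: continuous_intros)
    then show ?thesis by (simp add: split_beta)
  qed
  have der': "((\<lambda>y. f (1 - y)) has_real_derivative - D) (at x within {0..1})"
    if "(f has_real_derivative D) (at (1 - x) within {0..1})" for f :: "real \<Rightarrow> real" and D x
  proof -
    have image: "(\<lambda>y. 1 - y) ` {0..1} = {0..1::real}"
      by (simp add: image_diff_atLeastAtMost)
    have "((\<lambda>y. 1 - y) has_real_derivative - 1) (at x within {0..1})"
      by (auto intro!: derivative_eq_intros)
    from DERIV_image_chain[of f D "\<lambda>y. 1 - y" x "{0..1}", unfolded image, OF that this]
    show ?thesis by (simp add: o_def)
  qed
  show ?thesis
  proof
    show "\<nu> > 0" "\<gamma> > 0" "T > 0" by (fact nu_pos gamma_pos T_pos)+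
  next
    show "continuous_on ({0..1} \<times> {0..T}) (\<lambda>(x, t). \<rho> (1 - x) t)"
      "continuous_on ({0..1} \<times> {0..T}) (\<lambda>(x, t). \<rho>xx (1 - x) t)"
      "continuous_on ({0..1} \<times> {0..T}) (\<lambda>(x, t). \<rho>t (1 - x) t)"
      "continuous_on ({0..1} \<times> {0..T}) (\<lambda>(x, t). ux (1 - x) t)"
      by (intro cont' cont)+
    show "continuous_on ({0..1} \<times> {0..T}) (\<lambda>(x, t). - \<rho>x (1 - x) t)"
      "continuous_on ({0..1} \<times> {0..T}) (\<lambda>(x, t). - u (1 - x) t)"
      "continuous_on ({0..1} \<times> {0..T}) (\<lambda>(x, t). - uxx (1 - x) t)"
      using cont(2,5,7)[THEN cont', THEN continuous_on_minus] by (simp_all add: split_beta)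
  next
    fix x t :: real assume "x \<in> {0..1}" and t: "t \<in> {0..T}"
    then have x: "1 - x \<in> {0..1}" by auto
    show "((\<lambda>y. \<rho> (1 - y) t) has_real_derivative - \<rho>x (1 - x) t) (at x within {0..1})"
      "((\<lambda>y. ux (1 - y) t) has_real_derivative - uxx (1 - x) t) (at x within {0..1})"
      by (rule der'[OF der(1)[OF x t]], rule der'[OF der(5)[OF x t]])
    show "((\<lambda>y. - \<rho>x (1 - y) t) has_real_derivative \<rho>xx (1 - x) t) (at x within {0..1})"
      "((\<lambda>y. - u (1 - y) t) has_real_derivative ux (1 - x) t) (at x within {0..1})"
      using der(2,4)[OF x t, THEN der', THEN DERIV_minus] by simp_all
    show "((\<lambda>s. \<rho> (1 - x) s) has_real_derivative \<rho>t (1 - x) t) (at t within {0..T})"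
      "((\<lambda>s. - u (1 - x) s) has_real_derivative - ut (1 - x) t) (at t within {0..T})"
      using der(3,6)[OF x t] by (auto intro: DERIV_minus)
  next
    fix x t :: real assume "x \<in> {0<..<1}" and t: "t \<in> {0<..T}"
    then have x: "1 - x \<in> {0<..<1}" by auto
    show "\<rho>t (1 - x) t + - \<rho>x (1 - x) t * - u (1 - x) t + \<rho> (1 - x) t * ux (1 - x) t = 0"
      using mass[OF x t] by simp
    have "((\<lambda>y. 1 - y) has_real_derivative - 1) (at x)"
      by (auto intro!: derivative_eq_intros)
    from DERIV_chain2[OF momentum[OF x t] this]
    show "((\<lambda>y. \<rho> (1 - y) t powr \<gamma>) has_real_derivative \<nu> * - uxx (1 - x) t -
        \<rho> (1 - x) t * (- ut (1 - x) t + - u (1 - x) t * ux (1 - x) t)) (at x)"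
      by (simp add: algebra_simps)
  qed (use boundary in auto)
qed

end

section \<open>From classical solutions to the nonconservative equations\<close>

text \<open>The derivatives in the equations are only asserted to exist pointwise; uniqueness of
  derivatives identifies them with the continuous ones from \<open>C21\<close>. The product rule and
  the mass equation then remove the conservative form.\<close>

lemma classical_solution_imp_viscous_flow:
  fixes \<rho> u :: "real \<Rightarrow> real \<Rightarrow> real"
  assumes sol: "is_classical_solution \<nu> \<gamma> T \<rho>0 u0 \<rho> u" and "\<nu> > 0" "\<gamma> > 0" "T > 0"
  obtains \<rho>x \<rho>xx \<rho>t ux uxx ut where "viscous_flow \<nu> \<gamma> T \<rho> \<rho>x \<rho>xx \<rho>t u ux uxx ut"
proof -
  note sol = sol[unfolded is_classical_solution_def]
  obtain \<rho>x \<rho>xx \<rho>t where rho_cont: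
      "continuous_on ({0..1} \<times> {0..T}) (\<lambda>(x, t). \<rho> x t)"
      "continuous_on ({0..1} \<times> {0..T}) (\<lambda>(x, t). \<rho>x x t)"
      "continuous_on ({0..1} \<times> {0..T}) (\<lambda>(x, t). \<rho>xx x t)"
      "continuous_on ({0..1} \<times> {0..T}) (\<lambda>(x, t). \<rho>t x t)"
    and rho_der: "\<forall>x\<in>{0..1}. \<forall>t\<in>{0..T}.
      ((\<lambda>y. \<rho> y t) has_real_derivative \<rho>x x t) (at x within {0..1}) \<and>
      ((\<lambda>y. \<rho>x y t) has_real_derivative \<rho>xx x t) (at x within {0..1}) \<and>
      ((\<lambda>s. \<rho> x s) has_real_derivative \<rho>t x t) (at t within {0..T})"
    using sol unfolding C21_def by blast
  obtain ux uxx ut where u_cont: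
      "continuous_on ({0..1} \<times> {0..T}) (\<lambda>(x, t). u x t)"
      "continuous_on ({0..1} \<times> {0..T}) (\<lambda>(x, t). ux x t)"
      "continuous_on ({0..1} \<times> {0..T}) (\<lambda>(x, t). uxx x t)"
    and u_der: "\<forall>x\<in>{0..1}. \<forall>t\<in>{0..T}.
      ((\<lambda>y. u y t) has_real_derivative ux x t) (at x within {0..1}) \<and>
      ((\<lambda>y. ux y t) has_real_derivative uxx x t) (at x within {0..1}) \<and>
      ((\<lambda>s. u x s) has_real_derivative ut x t) (at t within {0..T})"
    using sol unfolding C21_def by blast
  have unique_x: "D = E" if "x \<in> {0..1}" "(f has_real_derivative D) (at x within {0..1})"
    "(f has_real_derivative E) (at x within {0..1})" for f :: "real \<Rightarrow> real" and D E x
    by (rule has_field_derivative_unique[OF that(2,3)])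
      (use that(1) in \<open>auto simp: trivial_limit_within islimpt_Icc\<close>)
  have unique_t: "D = E" if "t \<in> {0..T}" "(f has_real_derivative D) (at t within {0..T})"
    "(f has_real_derivative E) (at t within {0..T})" for f :: "real \<Rightarrow> real" and D E t
    by (rule has_field_derivative_unique[OF that(2,3)])
      (use that(1) \<open>T > 0\<close> in \<open>auto simp: trivial_limit_within islimpt_Icc\<close>)
  have interior:
    "((\<lambda>y. \<rho> y t) has_real_derivative \<rho>x x t) (at x)"
    "((\<lambda>s. \<rho> x s) has_real_derivative \<rho>t x t) (at t within {0..T})"
    "((\<lambda>y. u y t) has_real_derivative ux x t) (at x)"
    "((\<lambda>y. ux y t) has_real_derivative uxx x t) (at x)"
    "((\<lambda>s. u x s) has_real_derivative ut x t) (at t within {0..T})"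
    if "x \<in> {0<..<1}" "t \<in> {0<..T}" for x t
    using rho_der[rule_format, of x t] u_der[rule_format, of x t] that at_within_Icc_at[of 0 x 1]
    by auto
  have mass: "\<rho>t x t + \<rho>x x t * u x t + \<rho> x t * ux x t = 0"
    if x: "x \<in> {0<..<1}" and t: "t \<in> {0<..T}" for x t
  proof -
    obtain a b where ab: "((\<lambda>s. \<rho> x s) has_real_derivative a) (at t within {0..T})"
        "((\<lambda>y. \<rho> y t * u y t) has_real_derivative b) (at x)" "a + b = 0"
      using sol x t by blast
    have "a = \<rho>t x t" by (rule unique_t[OF _ ab(1) interior(2)[OF x t]]) (use t in auto)
    moreover have "b = \<rho>x x t * u x t + ux x t * \<rho> x t"
      by (rule DERIV_unique[OF ab(2) DERIV_mult[OF interior(1,3)[OF x t]]])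
    ultimately show ?thesis using ab(3) by (simp add: algebra_simps)
  qed
  show ?thesis
  proof (rule that[of \<rho>x \<rho>xx \<rho>t ux uxx ut], unfold_locales)
    fix x t assume x: "x \<in> {0<..<1::real}" and t: "t \<in> {0<..T}"
    then show "\<rho>t x t + \<rho>x x t * u x t + \<rho> x t * ux x t = 0" by (rule mass)
    obtain a b c where abc:
        "((\<lambda>s. \<rho> x s * u x s) has_real_derivative a) (at t within {0..T})"
        "((\<lambda>y. \<rho> y t * (u y t)\<^sup>2 + \<rho> y t powr \<gamma>) has_real_derivative b) (at x)"
        "((\<lambda>y. deriv (\<lambda>z. u z t) y) has_real_derivative c) (at x)" "a + b = \<nu> * c"
      using sol x t by blast
    have a: "a = \<rho>t x t * u x t + ut x t * \<rho> x t"
      by (rule unique_t[OF _ abc(1) DERIV_mult[OF interior(2,5)[OF x t]]]) (use t in auto)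
    \<comment> \<open>\<open>deriv\<close> refers to the two-sided derivative, which is known to
      equal \<open>ux\<close> on the open interval; agreement there suffices at an interior
      point.\<close>
    have "((\<lambda>y. ux y t) has_real_derivative c) (at x)"
      by (rule has_field_derivative_transform_within_open[OF abc(3), of "{0<..<1}"])
        (use x t interior(3) in \<open>auto intro: DERIV_imp_deriv\<close>)
    with interior(4)[OF x t] have c: "c = uxx x t" by (rule DERIV_unique[symmetric])
    have "((\<lambda>y. \<rho> y t * (u y t)\<^sup>2) has_real_derivative
        \<rho>x x t * (u x t)\<^sup>2 + 2 * u x t * ux x t * \<rho> x t) (at x)"
      by (rule derivative_eq_intros interior[OF x t] refl)+ simp
    \<comment> \<open>The equation only makes the sum of momentum flux and pressure differentiable.
      Subtracting the flux isolates the pressure, even where the density might vanish.\<close>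
    from DERIV_diff[OF abc(2) this]
    have "((\<lambda>y. \<rho> y t powr \<gamma>) has_real_derivative
        b - (\<rho>x x t * (u x t)\<^sup>2 + 2 * u x t * ux x t * \<rho> x t)) (at x)" by simp
    moreover have "b - (\<rho>x x t * (u x t)\<^sup>2 + 2 * u x t * ux x t * \<rho> x t) =
        \<nu> * uxx x t - \<rho> x t * (ut x t + u x t * ux x t)"
    proof -
      have rho_t: "\<rho>t x t = - \<rho>x x t * u x t - \<rho> x t * ux x t" using mass[OF x t] by simp
      have b: "b = \<nu> * uxx x t - (\<rho>t x t * u x t + ut x t * \<rho> x t)"
        using abc(4) unfolding a c by simp
      show ?thesis unfolding b rho_t by (simp add: algebra_simps power2_eq_square)
    qed
    ultimately show "((\<lambda>y. \<rho> y t powr \<gamma>) has_real_derivative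
        \<nu> * uxx x t - \<rho> x t * (ut x t + u x t * ux x t)) (at x)" by simp
  next
    fix t assume t: "t \<in> {0<..T}"
    then show "u 0 t = 0" "u 1 t = 0" using sol by auto
    have zero: "((\<lambda>y. u y t) has_real_derivative 0) (at x within {0..1})" if "x \<in> {0, 1}" for x
      using sol t that by blast
    have u_der': "((\<lambda>y. u y t) has_real_derivative ux x t) (at x within {0..1})"
      if "x \<in> {0..1}" for x
      using u_der t that by simp
    show "ux 0 t = 0" "ux 1 t = 0"
      by (rule unique_x[OF _ u_der' zero]; simp)+
  qed (use rho_cont u_cont rho_der u_der \<open>\<nu> > 0\<close> \<open>\<gamma> > 0\<close> \<open>T > 0\<close> in auto)
qed

theorem theorem2p1:
  fixes \<nu> \<gamma> :: real and \<rho>0 u0 :: "real \<Rightarrow> real"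
  assumes "\<nu> > 0" and "\<gamma> > 1"
    and "continuous_on {0..1} \<rho>0"
    and "\<forall>x\<in>{0<..<1}. \<rho>0 x > 0"
    and "\<rho>0 0 = 0" and "\<rho>0 1 = 0"
    and "continuous_on {0..1} u0"
    and "\<exists>l1 l2 l3 l4 :: real. 0 < l1 \<and> 0 < l2 \<and> 0 < l3 \<and> l3 < 1 \<and> 0 < l4 \<and> l4 < 1 \<and>
          ((  (\<forall>x\<in>{0<..<l3}. \<rho>0 differentiable (at x) \<and> deriv \<rho>0 x / \<rho>0 x \<ge> l1)
            \<and> u0 l3 < 0 \<and> (\<forall>x\<in>{0<..<l3}. u0 x \<le> 0))
         \<or> (  (\<forall>x\<in>{l4<..<1}. \<rho>0 differentiable (at x) \<and> deriv \<rho>0 x / \<rho>0 x \<le> - l2)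
            \<and> u0 l4 > 0 \<and> (\<forall>x\<in>{l4<..<1}. u0 x \<ge> 0)))"
  shows "\<forall>T>0. \<not> (\<exists>\<rho> u. is_classical_solution \<nu> \<gamma> T \<rho>0 u0 \<rho> u)"
proof (intro allI impI notI)
  fix T :: real assume "T > 0" and "\<exists>\<rho> u. is_classical_solution \<nu> \<gamma> T \<rho>0 u0 \<rho> u"
  then obtain \<rho> u where sol: "is_classical_solution \<nu> \<gamma> T \<rho>0 u0 \<rho> u" by blast
  with assms(1,2) \<open>T > 0\<close> obtain \<rho>x \<rho>xx \<rho>t ux uxx ut
    where flow: "viscous_flow \<nu> \<gamma> T \<rho> \<rho>x \<rho>xx \<rho>t u ux uxx ut"
    by (auto elim: classical_solution_imp_viscous_flow)
  interpret viscous_flow \<nu> \<gamma> T \<rho> \<rho>x \<rho>xx \<rho>t u ux uxx ut by (fact flow)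
  have init: "\<rho> x 0 = \<rho>0 x" "u x 0 = u0 x" if "x \<in> {0<..<1}" for x
    using sol that unfolding is_classical_solution_def by auto
  have pos: "0 < \<rho> x 0" if "x \<in> {0<..<1}" for x
    using assms(4) init that by simp
  \<comment> \<open>On the open interval \<open>\<rho>0\<close> coincides with \<open>\<rho>\<close>
    at time 0, so the logarithmic slope of the data is that of the solution.\<close>
  have slope: "deriv \<rho>0 x / \<rho>0 x = \<rho>x x 0 / \<rho> x 0" if "x \<in> {0<..<1}" for x
  proof -
    have "((\<lambda>y. \<rho> y 0) has_real_derivative \<rho>x x 0) (at x)"
      using der(1)[of x 0] that \<open>T > 0\<close> at_within_Icc_at[of 0 x 1] by auto
    then have "(\<rho>0 has_real_derivative \<rho>x x 0) (at x)"
      by (rule has_field_derivative_transform_within_open[of _ _ _ "{0<..<1}"])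
        (use that init in auto)
    then show ?thesis using init(1)[OF that] by (simp add: DERIV_imp_deriv)
  qed
  from assms(8) consider
      l r where "l > 0" "r \<in> {0<..<1}" "\<forall>x\<in>{0<..<r}. deriv \<rho>0 x / \<rho>0 x \<ge> l"
        "u0 r < 0" "\<forall>x\<in>{0<..<r}. u0 x \<le> 0"
    | l r where "l > 0" "r \<in> {0<..<1}" "\<forall>x\<in>{r<..<1}. deriv \<rho>0 x / \<rho>0 x \<le> - l"
        "u0 r > 0" "\<forall>x\<in>{r<..<1}. u0 x \<ge> 0"
    by (elim exE conjE disjE) auto
  then show False
  proof cases
    case 1
    show False
    proof (rule not_inward_at_left[OF 1(1,2)])
      fix x assume x: "x \<in> {0<..<r}"
      then have "l \<le> \<rho>x x 0 / \<rho> x 0" "0 < \<rho> x 0"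
        using 1(2) bspec[OF 1(3) x] slope[of x] pos[of x] by auto
      then show "l * \<rho> x 0 \<le> \<rho>x x 0" by (simp add: field_simps)
    qed (use 1 init pos in \<open>auto simp: less_imp_le\<close>)
  next
    case 2
    interpret R: viscous_flow \<nu> \<gamma> T "\<lambda>x t. \<rho> (1 - x) t" "\<lambda>x t. - \<rho>x (1 - x) t"
      "\<lambda>x t. \<rho>xx (1 - x) t" "\<lambda>x t. \<rho>t (1 - x) t" "\<lambda>x t. - u (1 - x) t"
      "\<lambda>x t. ux (1 - x) t" "\<lambda>x t. - uxx (1 - x) t" "\<lambda>x t. - ut (1 - x) t"
      by (rule reflect)
    \<comment> \<open>In the reflected flow the interval from \<open>r\<close> to 1 becomes the one
      from 0 to \<open>1 - r\<close>, and the upper bound \<open>- l\<close> on the logarithmic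
      slope becomes the lower bound \<open>l\<close>.\<close>
    show False
    proof (rule R.not_inward_at_left[OF 2(1), of "1 - r"])
      fix x assume x: "x \<in> {0<..<1 - r}"
      then have "\<rho>x (1 - x) 0 / \<rho> (1 - x) 0 \<le> - l" "0 < \<rho> (1 - x) 0"
        using 2(2) bspec[OF 2(3), of "1 - x"] slope[of "1 - x"] pos[of "1 - x"] by auto
      then show "l * \<rho> (1 - x) 0 \<le> - \<rho>x (1 - x) 0" by (simp add: field_simps)
    qed (use 2 init pos in \<open>auto simp: less_imp_le\<close>)
  qed
qed

end
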